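(* Let $\omega^u:\mathcal{G}\to\mathbb{N}_0$ be an MCP upper-bound function and let $k\ge 0$ be an integer. If $\omega^u$ is increasing, then a $(k,\omega^u)$-core of a graph is unique; that is, for every $G\in\mathcal{G}$, any two $(k,\omega^u)$-cores of $G$ are equal.
   Context: $\mathcal{G}$ is the class of all finite, simple, undirected graphs, and $\mathbb{N}_0=\{0,1,2,\dots\}$. For $G=(V,E)\in\mathcal{G}$, $N_G(v)$ is the set of neighbors of $v$, $G[S]$ is the subgraph induced by $S\subseteq V$, $H\subseteq G$ means that $H$ is a (not necessarily induced) subgraph of $G$, and $\omega(G)$ is the clique number (maximum size of a set of pairwise adjacent vertices). A function $\omega^u:\mathcal{G}\to\mathbb{N}_0$ is an MCP upper-bound function if $\omega(G)\le\omega^u(G)\le|V(G)|$ for every $G\in\mathcal{G}$. It is increasing if $G\subseteq G'$ implies $\omega^u(G)\le\omega^u(G')$ for all $G,G'\in\mathcal{G}$. A $(k,\omega^u)$-core of $G=(V,E)$ is a largest (maximum number of vertices) induced subgraph $G'=G[V']$, $V'\subseteq V$, such that $\omega^u(G'[N_{G'}(v)])\ge k$ for every vertex $v\in V'$. (The empty subgraph satisfies the condition vacuously.) *)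

theory Defs
  imports "Graph_Theory.Digraph_Component"
begin

text \<open>
  Finite simple undirected graphs are the structures satisfying \<^const>\<open>pair_graph\<close>: the vertex set
  is finite (possibly empty) and the edge set is given by a symmetric, irreflexive relation
  \<^const>\<open>parcs\<close> on it, an edge \<open>{u, v}\<close> being represented by the two arcs \<open>(u, v)\<close> and \<open>(v, u)\<close>.
  The (not necessarily induced) subgraph relation is \<^const>\<open>subgraph\<close>.
\<close>

text \<open>The counterpart of \<^const>\<open>induce_subgraph\<close> that stays within \<open>pair_pre_digraph\<close>.\<close>

definition pair_induce :: "'a pair_pre_digraph \<Rightarrow> 'a set \<Rightarrow> 'a pair_pre_digraph" where
  "pair_induce G S = \<lparr> pverts = S, parcs = {(u, v) \<in> parcs G. u \<in> S \<and> v \<in> S} \<rparr>"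

lemma with_proj_pair_induce: "with_proj (pair_induce G S) = with_proj G \<restriction> S"
  by (auto simp: with_proj_def pair_induce_def induce_subgraph_def)

lemma pair_graph_pair_induce:
  assumes "pair_graph G" and "S \<subseteq> pverts G"
  shows "pair_graph (pair_induce G S)"
proof -
  interpret pair_graph G by fact
  have "finite S" using assms(2) pair_finite_verts finite_subset by blast
  moreover have "finite {(u, v) \<in> parcs G. u \<in> S \<and> v \<in> S}"
    using pair_finite_arcs by (rule rev_finite_subset) auto
  ultimately show ?thesis
    using arcs_symmetric no_loops'
    by unfold_locales (auto simp: pair_induce_def symmetric_def intro!: symI)
qed

definition neighbors :: "'a pair_pre_digraph \<Rightarrow> 'a \<Rightarrow> 'a set" where
  "neighbors G v = {u. (v, u) \<in> parcs G}"

definition is_clique :: "'a pair_pre_digraph \<Rightarrow> 'a set \<Rightarrow> bool" where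
  "is_clique G S \<longleftrightarrow> S \<subseteq> pverts G \<and> (\<forall>u\<in>S. \<forall>v\<in>S. u \<noteq> v \<longrightarrow> (u, v) \<in> parcs G)"

definition clique_number :: "'a pair_pre_digraph \<Rightarrow> nat" where
  "clique_number G = Max {card S | S. is_clique G S}"

text \<open>
  A function on the class of finite simple graphs is a function on all of \<open>pair_pre_digraph\<close> about
  whose values outside \<^const>\<open>pair_graph\<close> nothing is assumed.
\<close>

definition mcp_upper_bound :: "('a pair_pre_digraph \<Rightarrow> nat) \<Rightarrow> bool" where
  "mcp_upper_bound w \<longleftrightarrow>
     (\<forall>G. pair_graph G \<longrightarrow> clique_number G \<le> w G \<and> w G \<le> card (pverts G))"

definition increasing :: "('a pair_pre_digraph \<Rightarrow> nat) \<Rightarrow> bool" where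
  "increasing w \<longleftrightarrow>
     (\<forall>G G'. pair_graph G \<and> pair_graph G' \<and> subgraph (with_proj G) (with_proj G') \<longrightarrow> w G \<le> w G')"

definition core_condition ::
    "nat \<Rightarrow> ('a pair_pre_digraph \<Rightarrow> nat) \<Rightarrow> 'a pair_pre_digraph \<Rightarrow> bool" where
  "core_condition k w H \<longleftrightarrow> (\<forall>v\<in>pverts H. k \<le> w (pair_induce H (neighbors H v)))"

definition is_core ::
    "nat \<Rightarrow> ('a pair_pre_digraph \<Rightarrow> nat) \<Rightarrow> 'a pair_pre_digraph \<Rightarrow> 'a pair_pre_digraph \<Rightarrow> bool" where
  "is_core k w G H \<longleftrightarrow>
     (\<exists>S \<subseteq> pverts G. H = pair_induce G S) \<and> core_condition k w H \<and>
     (\<forall>S \<subseteq> pverts G. core_condition k w (pair_induce G S) \<longrightarrow>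
        card (pverts (pair_induce G S)) \<le> card (pverts H))"

end

theory Submission
  imports Defs
begin

text \<open>
  Call a vertex set admissible if the subgraph it induces satisfies the core condition. Admissible
  sets are closed under union: passing from \<open>G[S]\<close> to \<open>G[S \<union> T]\<close> only enlarges the neighborhood
  subgraph of each vertex of \<open>S\<close>, so an increasing function stays at least \<open>k\<close> on it, and
  likewise for \<open>T\<close> (\<open>core_condition_Un\<close>). The vertex set of a core is an admissible set
  of maximum cardinality; if there were two distinct ones, their union would be admissible and
  strictly larger than both.
\<close>

lemma pverts_pair_induce [simp]: "pverts (pair_induce G S) = S"
  by (simp add: pair_induce_def)

lemma neighbors_subset_pverts:
  assumes "pair_graph G"
  shows "neighbors G v \<subseteq> pverts G"
proof -
  interpret pair_graph G by fact
  show ?thesis by (auto simp: neighbors_def dest: in_arcsD2)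
qed

lemma subgraph_with_projI:
  assumes "pair_graph H" and "pair_graph H'"
    and "pverts H \<subseteq> pverts H'" and "parcs H \<subseteq> parcs H'"
  shows "subgraph (with_proj H) (with_proj H')"
proof -
  interpret H: pair_graph H by fact
  interpret H': pair_graph H' by fact
  show ?thesis
    using assms(3,4) H.wf_digraph H'.wf_digraph
    by (simp add: subgraph_def compatible_def)
qed

lemma subgraph_neighborhood_mono:
  assumes "pair_graph H" and "pair_graph H'"
    and "pverts H \<subseteq> pverts H'" and "parcs H \<subseteq> parcs H'"
  shows "subgraph (with_proj (pair_induce H (neighbors H v)))
                  (with_proj (pair_induce H' (neighbors H' v)))"
proof (rule subgraph_with_projI)
  show "pair_graph (pair_induce H (neighbors H v))"
    and "pair_graph (pair_induce H' (neighbors H' v))"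
    using assms(1,2) by (simp_all add: pair_graph_pair_induce neighbors_subset_pverts)
qed (use assms(4) in \<open>auto simp: pair_induce_def neighbors_def\<close>)

lemma increasing_neighborhood_mono:
  assumes "increasing w" and "pair_graph G" and "S \<subseteq> T" and "T \<subseteq> pverts G"
  shows "w (pair_induce (pair_induce G S) (neighbors (pair_induce G S) v))
       \<le> w (pair_induce (pair_induce G T) (neighbors (pair_induce G T) v))"
proof -
  have graphs: "pair_graph (pair_induce G S)" "pair_graph (pair_induce G T)"
    using assms by (simp_all add: pair_graph_pair_induce)
  have arcs: "parcs (pair_induce G S) \<subseteq> parcs (pair_induce G T)"
    using assms(3) by (auto simp: pair_induce_def)
  have "subgraph (with_proj (pair_induce (pair_induce G S) (neighbors (pair_induce G S) v)))
                 (with_proj (pair_induce (pair_induce G T) (neighbors (pair_induce G T) v)))"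
    using graphs arcs assms(3) by (simp add: subgraph_neighborhood_mono)
  then show ?thesis
    using assms(1) graphs
    by (simp add: increasing_def pair_graph_pair_induce neighbors_subset_pverts
        del: pverts_pair_induce)
qed

text \<open>
  Each vertex of \<open>S \<union> T\<close> inherits its bound from whichever of \<open>G[S]\<close> and \<open>G[T]\<close> contains it.
\<close>

lemma core_condition_Un:
  assumes "increasing w" and "pair_graph G" and "S \<subseteq> pverts G" and "T \<subseteq> pverts G"
    and "core_condition k w (pair_induce G S)" and "core_condition k w (pair_induce G T)"
  shows "core_condition k w (pair_induce G (S \<union> T))"
  unfolding core_condition_def
proof
  fix v assume "v \<in> pverts (pair_induce G (S \<union> T))"
  then obtain U where U: "U = S \<or> U = T" "v \<in> U" by auto
  then have "k \<le> w (pair_induce (pair_induce G U) (neighbors (pair_induce G U) v))"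
    using assms(5,6) by (auto simp: core_condition_def)
  also have "\<dots> \<le> w (pair_induce (pair_induce G (S \<union> T)) (neighbors (pair_induce G (S \<union> T)) v))"
    using U assms(1-4) by (intro increasing_neighborhood_mono) auto
  finally show "k \<le> \<dots>" .
qed

text \<open>
  The union of \<open>S\<close> and \<open>T\<close> is again admissible, so maximality of the core forbids it to have more
  vertices than \<open>S\<close>.
\<close>

lemma core_greatest:
  assumes "increasing w" and "pair_graph G" and "is_core k w G (pair_induce G S)"
    and "S \<subseteq> pverts G" and "T \<subseteq> pverts G" and "core_condition k w (pair_induce G T)"
  shows "T \<subseteq> S"
proof -
  interpret pair_graph G by fact
  have "core_condition k w (pair_induce G (S \<union> T))"
    using assms by (intro core_condition_Un) (auto simp: is_core_def)
  then have "card (S \<union> T) \<le> card S"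
    using assms(3-5) by (auto simp: is_core_def)
  moreover have "finite (S \<union> T)"
    using assms(4,5) pair_finite_verts by (meson Un_least finite_subset)
  ultimately have "S = S \<union> T" by (intro card_seteq) auto
  then show ?thesis by auto
qed

theorem proposition10:
  fixes w :: "'a pair_pre_digraph \<Rightarrow> nat" and k :: nat
  assumes "mcp_upper_bound w"
    and "increasing w"
  shows "\<forall>G H H'. pair_graph G \<and> is_core k w G H \<and> is_core k w G H' \<longrightarrow> H = H'"
proof (intro allI impI, elim conjE)
  fix G H H' :: "'a pair_pre_digraph"
  assume G: "pair_graph G" and H: "is_core k w G H" and H': "is_core k w G H'"
  obtain S where S: "S \<subseteq> pverts G" "H = pair_induce G S"
    using H by (auto simp: is_core_def)
  obtain S' where S': "S' \<subseteq> pverts G" "H' = pair_induce G S'"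
    using H' by (auto simp: is_core_def)
  have "core_condition k w H" and "core_condition k w H'"
    using H H' by (simp_all add: is_core_def)
  then have "S' \<subseteq> S" and "S \<subseteq> S'"
    using core_greatest[OF assms(2) G] H H' S S' by blast+
  then show "H = H'" using S(2) S'(2) by simp
qed

end
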